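(* Let $\alpha$ be a rule of a simplified integer program $\mathcal{P}$ with program variables $\vec x$ and $\mathrm{guard}(\alpha)=(a_1\circ_1 0)\land\dots\land(a_k\circ_k 0)$ where $\circ_1,\dots,\circ_k\in\{>,\geq\}$. Let the family $(\sigma_n)_{n\in\mathbb{N}}$ be a solution of the limit problem $\{a_1^{\bullet_1},\dots,a_k^{\bullet_k}\}$ with $\bullet_1,\dots,\bullet_k\in\{+,+_!\}$. Then $\mathrm{rc}_{\mathcal{P}}(|\vec x\sigma_n|)\in\Omega(\mathrm{cost}(\alpha)\,\sigma_n)$ (as functions of $n$).
   Context: Fix a finite set $\Sigma$ of function symbols of common arity $k$ containing a start symbol $f_0$, and variables ranging over $\mathbb{Z}$. A rule has the form $f(\vec x)\xrightarrow{c}T\ [\varphi]$ where $\vec x=(x_1,\dots,x_k)$ is a fixed vector of pairwise different program variables, $f\in\Sigma$, $c$ an arithmetic expression (cost), $T$ a finite multiset of terms $g(t_1,\dots,t_k)$, $\varphi$ a finite conjunction of inequations between arithmetic expressions (guard). An integer program is a finite set of rules in which $f_0$ does not occur on right-hand sides; it is simplified if every rule has left-hand side $f_0(\vec x)$. An integer substitution maps variables of its domain to integers; $\sigma\models\varphi$ means all variables of $\varphi$ are in $\mathrm{dom}(\sigma)$ and $\sigma$ models $\varphi$. A configuration is a finite multiset of terms $f(n_1,\dots,n_k)$, $n_i\in\mathbb{Z}$. $S\xrightarrow{k}_{\mathcal{P}}T$ if there are $s\in S$, a rule $f(\vec x)\xrightarrow{c}Q\ [\varphi]$ in $\mathcal{P}$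 and an integer substitution $\sigma$ covering the rule's variables with $f(\vec x)\sigma=s$, $\sigma\models\varphi$, $c\sigma=k$, $T=(S\setminus\{s\})\cup Q\sigma$; costs of sequences are summed. $\mathrm{dh}_{\mathcal{P}}(S)=\sup\{k\mid S\xrightarrow{k}{}^{*}_{\mathcal{P}}T\}$, $\mathrm{rc}_{\mathcal{P}}(n)=\sup\{\mathrm{dh}_{\mathcal{P}}(f_0(\vec n))\mid\vec n\in\mathbb{Z}^k,\sum_i|n_i|\leq n\}\in\mathbb{R}_{\geq0}\cup\{\omega\}$, and $|\vec x\sigma_n|=\sum_i|x_i\sigma_n|$. A limit problem is a finite set of marked expressions $a^\bullet$ with $a$ an arithmetic expression and $\bullet\in\{+,-,+_!,-_!\}$. A function $f:\mathbb{N}\to\mathbb{R}$ satisfies $+$ (resp. $-$) if $\lim_{n\to\infty}f(n)=\infty$ (resp. $-\infty$), and satisfies $+_!$ (resp. $-_!$) if $\lim_{n\to\infty}f(n)=m$ for some real $m>0$ (resp. $m<0$). A family $(\sigma_n)_{n\in\mathbb{N}}$ of integer substitutions whose domains contain all variables of a limit problem $L$ is a solution of $L$ if for every $a^\bullet\in L$ the function $n\mapsto a\sigma_n$ satisfies $\bullet$. For $F,G:\mathbb{N}\to\mathbb{R}_{\geq0}\cup\{\omega\}$, $F\in\Omega(G)$ means there are $m>0$ and $n_0$ with $F(n)\geq m\cdot G(n)$ for all $n\geq n_0$. *)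

theory Defs
  imports Complex_Main "HOL-Library.Multiset" "HOL-Library.Extended_Real"
begin

section \<open>Arithmetic expressions\<close>

datatype 'v aexp =
    Var 'v
  | Num real
  | Add "'v aexp" "'v aexp"
  | Sub "'v aexp" "'v aexp"
  | Mul "'v aexp" "'v aexp"
  | Div "'v aexp" "'v aexp"
  | Pow "'v aexp" "'v aexp"

fun avars :: "'v aexp \<Rightarrow> 'v set" where
  "avars (Var v) = {v}"
| "avars (Num c) = {}"
| "avars (Add a b) = avars a \<union> avars b"
| "avars (Sub a b) = avars a \<union> avars b"
| "avars (Mul a b) = avars a \<union> avars b"
| "avars (Div a b) = avars a \<union> avars b"
| "avars (Pow a b) = avars a \<union> avars b"

text \<open>An integer substitution is a partial map; its domain is \<open>dom\<close>.\<close>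

type_synonym 'v isubst = "'v \<Rightarrow> int option"

text \<open>The value of an expression is a real number. It is \<open>None\<close> if a variable lies outside the
  domain of the substitution, or for division by zero or an undefined power; the conventions
  \<open>x / 0 = 0\<close> and the total \<open>powr\<close> of the library are deliberately not used.\<close>

definition div_val :: "real \<Rightarrow> real \<Rightarrow> real option" where
  "div_val x y = (if y = 0 then None else Some (x / y))"

definition pow_val :: "real \<Rightarrow> real \<Rightarrow> real option" where
  "pow_val x y =
     (if y \<in> \<int> \<and> (x \<noteq> 0 \<or> y \<ge> 0) then Some (x powi \<lfloor>y\<rfloor>)
      else if x > 0 then Some (x powr y)
      else if x = 0 \<and> y > 0 then Some 0
      else None)"

definition lift_val :: "(real \<Rightarrow> real \<Rightarrow> real option) \<Rightarrow> real option \<Rightarrow> real option \<Rightarrow> real option" where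
  "lift_val h u v = Option.bind u (\<lambda>x. Option.bind v (\<lambda>y. h x y))"

fun aeval :: "'v isubst \<Rightarrow> 'v aexp \<Rightarrow> real option" where
  "aeval \<sigma> (Var v) = map_option real_of_int (\<sigma> v)"
| "aeval \<sigma> (Num c) = Some c"
| "aeval \<sigma> (Add a b) = lift_val (\<lambda>x y. Some (x + y)) (aeval \<sigma> a) (aeval \<sigma> b)"
| "aeval \<sigma> (Sub a b) = lift_val (\<lambda>x y. Some (x - y)) (aeval \<sigma> a) (aeval \<sigma> b)"
| "aeval \<sigma> (Mul a b) = lift_val (\<lambda>x y. Some (x * y)) (aeval \<sigma> a) (aeval \<sigma> b)"
| "aeval \<sigma> (Div a b) = lift_val div_val (aeval \<sigma> a) (aeval \<sigma> b)"
| "aeval \<sigma> (Pow a b) = lift_val pow_val (aeval \<sigma> a) (aeval \<sigma> b)"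

section \<open>Guards\<close>

datatype ineq = Less | LessEq | Greater | GreaterEq

fun ineq_holds :: "ineq \<Rightarrow> real \<Rightarrow> real \<Rightarrow> bool" where
  "ineq_holds Less x y = (x < y)"
| "ineq_holds LessEq x y = (x \<le> y)"
| "ineq_holds Greater x y = (x > y)"
| "ineq_holds GreaterEq x y = (x \<ge> y)"

type_synonym 'v inequation = "'v aexp \<times> ineq \<times> 'v aexp"

text \<open>A list of inequations stands for their conjunction.\<close>

type_synonym 'v guard = "'v inequation list"

definition guard_vars :: "'v guard \<Rightarrow> 'v set" where
  "guard_vars \<phi> = (\<Union>(a, r, b) \<in> set \<phi>. avars a \<union> avars b)"

definition models :: "'v isubst \<Rightarrow> 'v guard \<Rightarrow> bool" where
  "models \<sigma> \<phi> \<longleftrightarrow> guard_vars \<phi> \<subseteq> dom \<sigma> \<and>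
     (\<forall>(a, r, b) \<in> set \<phi>. \<exists>x y. aeval \<sigma> a = Some x \<and> aeval \<sigma> b = Some y \<and> ineq_holds r x y)"

section \<open>Integer programs\<close>

text \<open>The argument vector of every left-hand side is the fixed vector of program variables, so a
  rule stores only the root symbol of its left-hand side.\<close>

datatype ('f, 'v) rule =
  Rule (root: 'f) (cost: "'v aexp") (rhs: "('f \<times> 'v aexp list) multiset") (guard: "'v guard")

definition rule_vars :: "'v list \<Rightarrow> ('f, 'v) rule \<Rightarrow> 'v set" where
  "rule_vars xs \<alpha> = set xs \<union> avars (cost \<alpha>) \<union> guard_vars (guard \<alpha>) \<union>
     (\<Union>(g, ts) \<in> set_mset (rhs \<alpha>). \<Union>t \<in> set ts. avars t)"

text \<open>The common arity of the function symbols in \<open>\<Sigma>\<close> is \<open>length xs\<close>.\<close>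

definition integer_program :: "'f set \<Rightarrow> 'f \<Rightarrow> 'v list \<Rightarrow> ('f, 'v) rule set \<Rightarrow> bool" where
  "integer_program \<Sigma> f0 xs P \<longleftrightarrow>
     finite \<Sigma> \<and> f0 \<in> \<Sigma> \<and> distinct xs \<and> finite P \<and>
     (\<forall>\<alpha> \<in> P. root \<alpha> \<in> \<Sigma> \<and>
        (\<forall>(g, ts) \<in> set_mset (rhs \<alpha>). g \<in> \<Sigma> \<and> g \<noteq> f0 \<and> length ts = length xs))"

definition simplified :: "'f \<Rightarrow> ('f, 'v) rule set \<Rightarrow> bool" where
  "simplified f0 P \<longleftrightarrow> (\<forall>\<alpha> \<in> P. root \<alpha> = f0)"

section \<open>Evaluation and complexity\<close>

text \<open>Instantiated terms carry the values of their arguments. An expression on a right-hand side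
  may have a non-integer or undefined value; the resulting term is then kept, but it is not an
  instance of any left-hand side under an integer substitution and hence cannot be evaluated
  further. If right-hand sides take integer values whenever the guard holds, then everything
  reachable from an integer configuration is an integer configuration.\<close>

type_synonym 'f gterm = "'f \<times> real option list"

definition inst :: "'v isubst \<Rightarrow> 'f \<times> 'v aexp list \<Rightarrow> 'f gterm" where
  "inst \<sigma> t = (fst t, map (aeval \<sigma>) (snd t))"

definition int_term :: "'f \<Rightarrow> int list \<Rightarrow> 'f gterm" where
  "int_term f ns = (f, map (\<lambda>n. Some (real_of_int n)) ns)"

definition step ::
  "'v list \<Rightarrow> ('f, 'v) rule set \<Rightarrow> 'f gterm multiset \<Rightarrow> real \<Rightarrow> 'f gterm multiset \<Rightarrow> bool" where
  "step xs P S k T \<longleftrightarrow>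
     (\<exists>s \<alpha> \<sigma>. s \<in># S \<and> \<alpha> \<in> P \<and> rule_vars xs \<alpha> \<subseteq> dom \<sigma> \<and>
        inst \<sigma> (root \<alpha>, map Var xs) = s \<and> models \<sigma> (guard \<alpha>) \<and>
        aeval \<sigma> (cost \<alpha>) = Some k \<and>
        T = (S - {#s#}) + image_mset (inst \<sigma>) (rhs \<alpha>))"

inductive steps ::
  "'v list \<Rightarrow> ('f, 'v) rule set \<Rightarrow> 'f gterm multiset \<Rightarrow> real \<Rightarrow> 'f gterm multiset \<Rightarrow> bool"
  for xs P where
  refl: "steps xs P S 0 S"
| step: "step xs P S k T \<Longrightarrow> steps xs P T l U \<Longrightarrow> steps xs P S (k + l) U"

text \<open>The value \<open>\<omega>\<close> is \<open>\<infinity>\<close>. The empty sequence makes \<open>dh\<close>, and hence \<open>rc\<close>, non-negative.\<close>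

definition dh :: "'v list \<Rightarrow> ('f, 'v) rule set \<Rightarrow> 'f gterm multiset \<Rightarrow> ereal" where
  "dh xs P S = Sup {ereal k | k T. steps xs P S k T}"

definition rc :: "'f \<Rightarrow> 'v list \<Rightarrow> ('f, 'v) rule set \<Rightarrow> nat \<Rightarrow> ereal" where
  "rc f0 xs P n =
     Sup {dh xs P {#int_term f0 ns#} | ns. length ns = length xs \<and> (\<Sum>i\<leftarrow>ns. \<bar>i\<bar>) \<le> int n}"

definition subst_size :: "'v list \<Rightarrow> 'v isubst \<Rightarrow> nat" where
  "subst_size xs \<sigma> = nat (\<Sum>x\<leftarrow>xs. \<bar>the (\<sigma> x)\<bar>)"

definition Omega :: "(nat \<Rightarrow> ereal) \<Rightarrow> (nat \<Rightarrow> ereal) set" where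
  "Omega G = {F. \<exists>m::real. m > 0 \<and> (\<exists>n0. \<forall>n \<ge> n0. F n \<ge> ereal m * G n)}"

section \<open>Limit problems\<close>

datatype mark = Pos | Neg | PosFin | NegFin

fun satisfies :: "(nat \<Rightarrow> real) \<Rightarrow> mark \<Rightarrow> bool" where
  "satisfies f Pos = filterlim f at_top sequentially"
| "satisfies f Neg = filterlim f at_bot sequentially"
| "satisfies f PosFin = (\<exists>m > 0. f \<longlonglongrightarrow> m)"
| "satisfies f NegFin = (\<exists>m < 0. f \<longlonglongrightarrow> m)"

definition limit_problem :: "('v aexp \<times> mark) set \<Rightarrow> bool" where
  "limit_problem L \<longleftrightarrow> finite L"

definition solution :: "(nat \<Rightarrow> 'v isubst) \<Rightarrow> ('v aexp \<times> mark) set \<Rightarrow> bool" where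
  "solution \<sigma> L \<longleftrightarrow> limit_problem L \<and>
     (\<forall>(a, b) \<in> L. (\<forall>n. avars a \<subseteq> dom (\<sigma> n)) \<and>
        (\<exists>f. (\<forall>n. aeval (\<sigma> n) a = Some (f n)) \<and> satisfies f b))"

end

theory Submission imports Defs begin

text \<open>Every guard expression tends to \<open>\<infinity>\<close> or to a positive limit, so \<open>\<sigma> n\<close> satisfies the guard for
  all large \<open>n\<close>. Then the rule applies to \<open>f0\<close> with arguments \<open>xs\<sigma>\<^sub>n\<close>, and this single step
  already has the required cost.\<close>

lemma lift_val_eq_Some_iff:
  "lift_val h u v = Some z \<longleftrightarrow> (\<exists>x y. u = Some x \<and> v = Some y \<and> h x y = Some z)"
  by (auto simp: lift_val_def bind_eq_Some_conv)

text \<open>Undefinedness is strict: \<open>lift_val\<close> yields a value only if both operands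
  have one. A defined value therefore reads only variables in the domain of \<sigma>, where \<tau>
  agrees with \<sigma>.\<close>

lemma aeval_mono:
  assumes "\<sigma> \<subseteq>\<^sub>m \<tau>" and "aeval \<sigma> e = Some z"
  shows "aeval \<tau> e = Some z"
  using assms(2)
proof (induction e arbitrary: z)
  case (Var v)
  with assms(1) show ?case
    by (metis aeval.simps(1) domIff map_le_def option.map_disc_iff option.simps(3))
qed (auto simp: lift_val_eq_Some_iff)

lemma satisfies_eventually_pos:
  assumes "satisfies f m" and "m \<in> {Pos, PosFin}"
  shows "\<forall>\<^sub>F n in sequentially. f n > 0"
  using assms by (auto simp: filterlim_at_top_dense dest: order_tendstoD(1))

text \<open>\<open>\<sigma>\<close> need not cover the variables of the right-hand side, so it is extended arbitrarily.\<close>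

lemma step_from_int_term:
  assumes "\<alpha> \<in> P" and "set xs \<subseteq> dom \<sigma>" and "models \<sigma> (guard \<alpha>)"
    and "aeval \<sigma> (cost \<alpha>) = Some c"
  shows "\<exists>T. step xs P {#int_term (root \<alpha>) (map (\<lambda>x. the (\<sigma> x)) xs)#} c T"
proof -
  \<comment> \<open>The right operand of \<open>++\<close> takes precedence, so 0 is used only
    outside \<open>dom \<sigma>\<close>.\<close>
  define \<tau> where "\<tau> = (\<lambda>_. Some 0) ++ \<sigma>"
  have le: "\<sigma> \<subseteq>\<^sub>m \<tau>" and dom: "dom \<tau> = UNIV"
    by (auto simp: \<tau>_def)
  have "\<tau> x = Some (the (\<sigma> x))" if "x \<in> set xs" for x
    using that assms(2) by (auto simp: \<tau>_def map_add_def)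
  then have "inst \<tau> (root \<alpha>, map Var xs) = int_term (root \<alpha>) (map (\<lambda>x. the (\<sigma> x)) xs)"
    by (simp add: inst_def int_term_def)
  moreover have "models \<tau> (guard \<alpha>)"
    using assms(3) dom aeval_mono[OF le] unfolding models_def by fast
  moreover have "aeval \<tau> (cost \<alpha>) = Some c"
    using assms(4) by (rule aeval_mono[OF le])
  ultimately show ?thesis
    using assms(1) dom unfolding step_def
    by (metis subset_UNIV union_single_eq_member add_mset_add_single add_0)
qed

lemma step_cost_le_dh:
  assumes "step xs P S c T"
  shows "ereal c \<le> dh xs P S"
proof -
  have "steps xs P S c T"
    using steps.step[OF assms steps.refl] by simp
  then show ?thesis
    unfolding dh_def by (auto intro: Sup_upper)
qed

lemma dh_le_rc_subst_size:
  "dh xs P {#int_term f (map (\<lambda>x. the (\<sigma> x)) xs)#} \<le> rc f xs P (subst_size xs \<sigma>)"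
proof -
  \<comment> \<open>\<open>subst_size\<close> applies \<open>nat\<close>, which truncates negative
    numbers to 0; nonnegativity ensures that \<open>int\<close> recovers the sum, so this argument
    vector is among those over which \<open>rc\<close> takes its supremum.\<close>
  have "(\<Sum>x\<leftarrow>xs. \<bar>the (\<sigma> x)\<bar>) \<ge> 0"
    by (rule sum_list_nonneg) auto
  then have "(\<Sum>i\<leftarrow>map (\<lambda>x. the (\<sigma> x)) xs. \<bar>i\<bar>) \<le> int (subst_size xs \<sigma>)"
    by (simp add: subst_size_def comp_def)
  then show ?thesis
    unfolding rc_def by (intro Sup_upper CollectI exI[of _ "map (\<lambda>x. the (\<sigma> x)) xs"]) simp
qed

lemma solution_eventually_models:
  assumes \<phi>: "\<phi> = map (\<lambda>i. (a i, r i, Num 0)) [1..<Suc k]"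
    and r: "\<And>i. i \<in> {1..k} \<Longrightarrow> r i \<in> {Greater, GreaterEq}"
    and b: "\<And>i. i \<in> {1..k} \<Longrightarrow> b i \<in> {Pos, PosFin}"
    and sol: "solution \<sigma> ((\<lambda>i. (a i, b i)) ` {1..k})"
  shows "\<forall>\<^sub>F n in sequentially. models (\<sigma> n) \<phi>"
proof -
  have set_\<phi>: "set \<phi> = (\<lambda>i. (a i, r i, Num 0)) ` {1..k}"
    by (auto simp: \<phi>)
  \<comment> \<open>A solution covers the variables of each \<open>a i\<close> at every index, not
    just eventually, and \<open>Num 0\<close> contributes none.\<close>
  have vars: "guard_vars \<phi> \<subseteq> dom (\<sigma> n)" for n
    using sol by (fastforce simp: guard_vars_def set_\<phi> solution_def)
  have "\<forall>\<^sub>F n in sequentially. \<exists>x>0. aeval (\<sigma> n) (a i) = Some x" if i: "i \<in> {1..k}" for i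
  proof -
    obtain f where "\<And>n. aeval (\<sigma> n) (a i) = Some (f n)" "satisfies f (b i)"
      using sol i unfolding solution_def by blast
    then show ?thesis
      using satisfies_eventually_pos[OF _ b[OF i]] by simp
  qed
  \<comment> \<open>The thresholds depend on \<open>i\<close>; since \<open>{1..k}\<close> is
    finite, they have a common bound.\<close>
  then have "\<forall>\<^sub>F n in sequentially. \<forall>i\<in>{1..k}. \<exists>x>0. aeval (\<sigma> n) (a i) = Some x"
    by (intro eventually_ball_finite) auto
  then show ?thesis
  proof eventually_elim
    case (elim n)
    \<comment> \<open>Strict positivity settles \<open>Greater\<close> and \<open>GreaterEq\<close>
      alike.\<close>
    have "\<exists>x. aeval (\<sigma> n) (a i) = Some x \<and> ineq_holds (r i) x 0" if "i \<in> {1..k}" for i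
      using bspec[OF elim that] r[OF that] by (auto intro: less_imp_le)
    then show ?case
      using vars by (auto simp: models_def set_\<phi>)
  qed
qed

theorem theorem5p5:
  fixes \<Sigma> :: "'f set" and f0 :: 'f and xs :: "'v list" and P :: "('f, 'v) rule set"
    and \<alpha> :: "('f, 'v) rule" and k :: nat
    and a :: "nat \<Rightarrow> 'v aexp" and r :: "nat \<Rightarrow> ineq" and b :: "nat \<Rightarrow> mark"
    and \<sigma> :: "nat \<Rightarrow> 'v isubst" and C :: "nat \<Rightarrow> real"
  assumes "integer_program \<Sigma> f0 xs P"
    and "simplified f0 P"
    and "\<alpha> \<in> P"
    and "guard \<alpha> = map (\<lambda>i. (a i, r i, Num 0)) [1..<Suc k]"
    and "\<And>i. i \<in> {1..k} \<Longrightarrow> r i \<in> {Greater, GreaterEq}"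
    and "\<And>i. i \<in> {1..k} \<Longrightarrow> b i \<in> {Pos, PosFin}"
    and "solution \<sigma> ((\<lambda>i. (a i, b i)) ` {1..k})"
    and "\<And>n. set xs \<subseteq> dom (\<sigma> n)"
    and "\<And>n. aeval (\<sigma> n) (cost \<alpha>) = Some (C n)"
  shows "(\<lambda>n. rc f0 xs P (subst_size xs (\<sigma> n))) \<in> Omega (\<lambda>n. ereal (C n))"
proof -
  have "\<forall>\<^sub>F n in sequentially. models (\<sigma> n) (guard \<alpha>)"
    using assms(4-7) by (rule solution_eventually_models)
  \<comment> \<open>The constant in \<open>Omega\<close> is 1, because the step costs exactly
    \<open>C n\<close>.\<close>
  then have "\<forall>\<^sub>F n in sequentially. ereal 1 * ereal (C n) \<le> rc f0 xs P (subst_size xs (\<sigma> n))"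
  proof eventually_elim
    case (elim n)
    \<comment> \<open>Simplification lets \<alpha> fire directly on a start term, so no reachability
      argument is required.\<close>
    have "root \<alpha> = f0"
      using assms(2,3) by (simp add: simplified_def)
    then obtain T where "step xs P {#int_term f0 (map (\<lambda>x. the (\<sigma> n x)) xs)#} (C n) T"
      using step_from_int_term[OF assms(3,8) elim assms(9)] by blast
    then have "ereal (C n) \<le> dh xs P {#int_term f0 (map (\<lambda>x. the (\<sigma> n x)) xs)#}"
      by (rule step_cost_le_dh)
    also have "\<dots> \<le> rc f0 xs P (subst_size xs (\<sigma> n))"
      by (rule dh_le_rc_subst_size)
    finally show ?case
      by simp
  qed
  then show ?thesis
    unfolding Omega_def eventually_sequentially by (blast intro: zero_less_one)
qed

end
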